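(* Let $n\geq 4$ be an integer and let $LG_n^C$ be the complement of the Ladder graph $LG_n = P_2\,\square\, P_n$. Then $\gamma_{SR}(LG_n^C) = 2$.
   Context: All graphs are finite, simple and undirected. For a vertex $u$ of a graph $G$, $N_G[u]$ denotes the closed neighbourhood of $u$ (the vertex $u$ together with all vertices adjacent to $u$). A signed Roman dominating function (SRDF) on $G$ is a function $f: V(G)\to\{-1,1,2\}$ such that (i) $\sum_{v\in N_G[u]} f(v)\geq 1$ for every $u\in V(G)$, and (ii) every vertex $u$ with $f(u)=-1$ is adjacent to at least one vertex $v$ with $f(v)=2$. The weight of $f$ is $w(f)=\sum_{u\in V(G)} f(u)$, and the signed Roman domination number $\gamma_{SR}(G)$ is the minimum weight of an SRDF on $G$. The Ladder graph $LG_n$ has vertex set $\{(1,i),(2,i): 1\le i\le n\}$ and edges $\{(1,i),(2,i)\}$ for $1\le i\le n$, and $\{(1,i),(1,i+1)\}$, $\{(2,i),(2,i+1)\}$ for $1\le i\le n-1$. The complement $G^C$ of a graph $G$ has the same vertex set, with distinct $u,v$ adjacent in $G^C$ iff they are not adjacent in $G$. *)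

theory Defs
  imports Main "HOL-Library.FuncSet"
begin

record 'a ugraph =
  verts :: "'a set"
  edges :: "'a set set"

definition simple_graph :: "'a ugraph \<Rightarrow> bool" where
  "simple_graph G \<longleftrightarrow>
     finite (verts G) \<and> (\<forall>e\<in>edges G. e \<subseteq> verts G \<and> card e = 2)"

definition adjacent :: "'a ugraph \<Rightarrow> 'a \<Rightarrow> 'a \<Rightarrow> bool" where
  "adjacent G u v \<longleftrightarrow> {u, v} \<in> edges G"

definition closed_nbhd :: "'a ugraph \<Rightarrow> 'a \<Rightarrow> 'a set" where
  "closed_nbhd G u = insert u {v \<in> verts G. adjacent G u v}"

definition complement_graph :: "'a ugraph \<Rightarrow> 'a ugraph" where
  "complement_graph G =
     \<lparr>verts = verts G,
      edges = {{u, v} | u v. u \<in> verts G \<and> v \<in> verts G \<and> u \<noteq> v \<and> \<not> adjacent G u v}\<rparr>"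

definition ladder_graph :: "nat \<Rightarrow> (nat \<times> nat) ugraph" where
  "ladder_graph n =
     \<lparr>verts = {1, 2} \<times> {1..n},
      edges = {{(1, i), (2, i)} | i. 1 \<le> i \<and> i \<le> n}
            \<union> {{(1, i), (1, i + 1)} | i. 1 \<le> i \<and> i + 1 \<le> n}
            \<union> {{(2, i), (2, i + 1)} | i. 1 \<le> i \<and> i + 1 \<le> n}\<rparr>"

definition SRDF :: "'a ugraph \<Rightarrow> ('a \<Rightarrow> int) \<Rightarrow> bool" where
  "SRDF G f \<longleftrightarrow>
     f \<in> verts G \<rightarrow> {-1, 1, 2} \<and>
     (\<forall>u\<in>verts G. (\<Sum>v\<in>closed_nbhd G u. f v) \<ge> 1) \<and>
     (\<forall>u\<in>verts G. f u = -1 \<longrightarrow> (\<exists>v\<in>verts G. adjacent G u v \<and> f v = 2))"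

definition weight :: "'a ugraph \<Rightarrow> ('a \<Rightarrow> int) \<Rightarrow> int" where
  "weight G f = (\<Sum>u\<in>verts G. f u)"

text \<open>The minimum below is taken over a finite nonempty set whenever \<open>G\<close> is a
  finite graph; see \<open>finite_SRDF_weights\<close> and \<open>SRDF_weights_nonempty\<close>.\<close>

definition signed_Roman_domination_number :: "'a ugraph \<Rightarrow> int" (\<open>\<gamma>\<^sub>S\<^sub>R\<close>) where
  "\<gamma>\<^sub>S\<^sub>R G = Min {weight G f | f. SRDF G f}"

lemma finite_SRDF_weights:
  assumes "simple_graph G"
  shows "finite {weight G f | f. SRDF G f}"
proof (rule finite_subset)
  have fin: "finite (verts G)"
    using assms by (simp add: simple_graph_def)
  show "{weight G f | f. SRDF G f} \<subseteq> weight G ` (verts G \<rightarrow>\<^sub>E {-1, 1, 2})"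
  proof
    fix w assume "w \<in> {weight G f | f. SRDF G f}"
    then obtain f where w: "w = weight G f" and f: "SRDF G f"
      by blast
    have "w = weight G (restrict f (verts G))"
      using w by (simp add: weight_def)
    moreover have "restrict f (verts G) \<in> verts G \<rightarrow>\<^sub>E {-1, 1, 2}"
      using f by (auto simp: SRDF_def)
    ultimately show "w \<in> weight G ` (verts G \<rightarrow>\<^sub>E {-1, 1, 2})"
      by blast
  qed
  show "finite (weight G ` (verts G \<rightarrow>\<^sub>E {-1, 1, 2}))"
    using fin by (intro finite_imageI finite_PiE) auto
qed

lemma SRDF_weights_nonempty:
  assumes "simple_graph G"
  shows "{weight G f | f. SRDF G f} \<noteq> {}"
proof -
  have "card (closed_nbhd G u) \<ge> 1" if "u \<in> verts G" for u
    using assms by (auto simp: closed_nbhd_def simple_graph_def card_insert_if card_gt_0_iff Suc_le_eq)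
  then have "SRDF G (\<lambda>_. 1)"
    by (force simp: SRDF_def)
  then show ?thesis
    by blast
qed

lemma simple_graph_ladder: "simple_graph (ladder_graph n)"
  by (auto simp: simple_graph_def ladder_graph_def card_insert_if)

lemma simple_graph_complement:
  "simple_graph G \<Longrightarrow> simple_graph (complement_graph G)"
  by (auto simp: simple_graph_def complement_graph_def card_insert_if)

lemma adjacent_complement_iff:
  "u \<in> verts G \<Longrightarrow> v \<in> verts G \<Longrightarrow>
   adjacent (complement_graph G) u v \<longleftrightarrow> u \<noteq> v \<and> \<not> adjacent G u v"
  by (auto simp: adjacent_def complement_graph_def doubleton_eq_iff insert_commute)

end

theory Submission
  imports Defs
begin

text \<open>In \<open>G\<^sup>C\<close> the closed neighbourhood condition at \<open>u\<close> says that the open neighbourhood of \<open>u\<close>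
  in \<open>G\<close> has \<open>f\<close>-sum at most \<open>w(f) - 1\<close>. The two checkerboard classes of the ladder are
  zigzags, each meeting every column once, and the open neighbourhood of a vertex consists of
  three consecutive vertices of a zigzag (two at the ends). Each zigzag is a disjoint union of
  such windows, so if \<open>w \<le> 1\<close> both zigzags have sum at most \<open>w - 1\<close>, whence \<open>w \<le> 2(w - 1)\<close>,
  a contradiction. Conversely, weight 2 is attained by a function constant on columns that
  follows the pattern \<open>2, -1, -1, 2, -1, -1, \<dots>\<close> with an adjustment at the right end.\<close>

section \<open>Neighbourhood sums in the ladder and its complement\<close>

lemma verts_complement [simp]: "verts (complement_graph G) = verts G"
  by (simp add: complement_graph_def)

text \<open>A simple graph has no loops, so the closed neighbourhood of \<open>u\<close> in the
  complement is exactly what the open neighbourhood of \<open>u\<close> in \<open>G\<close> leaves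
  over.\<close>

lemma closed_nbhd_sum_complement:
  assumes G: "simple_graph G" and u: "u \<in> verts G"
  shows "(\<Sum>v\<in>closed_nbhd (complement_graph G) u. f v)
           = weight G f - (\<Sum>v\<in>{v \<in> verts G. adjacent G u v}. f v)"
proof -
  have "{u} \<notin> edges G"
    using G by (auto simp: simple_graph_def)
  then have "\<not> adjacent G u u"
    by (simp add: adjacent_def)
  then have "closed_nbhd (complement_graph G) u = verts G - {v \<in> verts G. adjacent G u v}"
    using u by (auto simp: closed_nbhd_def adjacent_complement_iff)
  then show ?thesis
    using G by (simp add: weight_def simple_graph_def sum_diff)
qed

lemma weight_complement [simp]: "weight (complement_graph G) f = weight G f"
  by (simp add: weight_def)

lemma verts_ladder: "verts (ladder_graph n) = {1, 2} \<times> {1..n}"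
  by (simp add: ladder_graph_def)

lemma adjacent_ladder_iff:
  assumes "r \<in> {1, 2}" "i \<in> {1..n}" "v \<in> verts (ladder_graph n)"
  shows "adjacent (ladder_graph n) (r, i) v \<longleftrightarrow> v \<in> {(3 - r, i), (r, i - 1), (r, i + 1)}"
proof -
  obtain q j where v: "v = (q, j)"
    by (cases v)
  have "q \<in> {1, 2}" "j \<in> {1..n}"
    using assms(3) by (auto simp: verts_ladder v)
  have "adjacent (ladder_graph n) (r, i) (q, j) \<longleftrightarrow>
      q \<noteq> r \<and> j = i \<or> q = r \<and> i = j + 1 \<or> q = r \<and> j = i + 1" (is "?L \<longleftrightarrow> ?R")
  proof
    assume ?L
    then obtain k where "{(r, i), (q, j)} = {(1, k), (2, k)}
        \<or> {(r, i), (q, j)} = {(1, k), (1, k + 1)} \<or> {(r, i), (q, j)} = {(2, k), (2, k + 1)}"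
      unfolding adjacent_def ladder_graph_def ugraph.simps by blast
    then show ?R
      by (elim disjE) (auto simp: doubleton_eq_iff)
  next
    have rungs: "{(1, k), (2, k)} \<in> edges (ladder_graph n)" if "k \<in> {1..n}" for k
      using that by (auto simp: ladder_graph_def)
    have rails: "{(p, k), (p, k + 1)} \<in> edges (ladder_graph n)"
      if "p \<in> {1, 2}" "k \<in> {1..n}" "k + 1 \<in> {1..n}" for p k
      using that by (auto simp: ladder_graph_def)
    assume ?R
    then show ?L
      using assms(1,2) \<open>q \<in> {1, 2}\<close> \<open>j \<in> {1..n}\<close> rungs[of i] rails[of q i] rails[of q j]
      unfolding adjacent_def by (auto simp: insert_commute)
  qed
  moreover have "q = 3 - r \<longleftrightarrow> q \<noteq> r"
    using assms(1) \<open>q \<in> {1, 2}\<close> by (elim insertE emptyE) simp_all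
  \<comment> \<open>Subtraction on \<open>nat\<close> truncates, so this relies on
    \<open>i \<ge> 1\<close>.\<close>
  moreover have "j = i - 1 \<longleftrightarrow> i = j + 1"
    using assms(2) unfolding atLeastAtMost_iff by arith
  ultimately show ?thesis
    by (simp only: v insert_iff empty_iff prod.inject simp_thms)
qed

text \<open>Extending \<open>f\<close> by 0 to the fictitious columns 0 and \<open>n + 1\<close>
  lets the end columns share the three-term formula of the inner ones.\<close>

lemma ladder_nbhd_sum:
  fixes f :: "nat \<times> nat \<Rightarrow> int" and n :: nat
  defines "F \<equiv> \<lambda>v. if v \<in> verts (ladder_graph n) then f v else 0"
  assumes "r \<in> {1, 2}" "i \<in> {1..n}"
  shows "(\<Sum>v\<in>{v \<in> verts (ladder_graph n). adjacent (ladder_graph n) (r, i) v}. f v)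
           = F (r, i - 1) + F (3 - r, i) + F (r, i + 1)"
proof -
  let ?N = "{(3 - r, i), (r, i - 1), (r, i + 1)}"
  have "{v \<in> verts (ladder_graph n). adjacent (ladder_graph n) (r, i) v}
          = ?N \<inter> verts (ladder_graph n)"
    using adjacent_ladder_iff[OF assms(2,3)] by blast
  then have "(\<Sum>v\<in>{v \<in> verts (ladder_graph n). adjacent (ladder_graph n) (r, i) v}. f v)
          = (\<Sum>v\<in>?N. F v)"
    by (simp only: sum.inter_restrict F_def finite.intros)
  also have "\<dots> = F (r, i - 1) + F (3 - r, i) + F (r, i + 1)"
    using assms(2,3) by auto
  finally show ?thesis .
qed

section \<open>Lower bound: tiling zigzags by windows\<close>

lemma sum_blocks_le:
  fixes h :: "nat \<Rightarrow> int"
  assumes "\<And>j. j \<le> k \<Longrightarrow> h (s + 3 * j) + h (s + 3 * j + 1) + h (s + 3 * j + 2) \<le> c" and "c \<le> 0"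
  shows "(\<Sum>i<3 * k + 3. h (s + i)) \<le> c"
  using assms(1)
proof (induction k)
  case 0
  from 0[of 0] show ?case by (simp add: numeral_3_eq_3)
next
  case (Suc k)
  have "(\<Sum>i<3 * k + 3. h (s + i)) \<le> c"
    using Suc by simp
  moreover have "h (s + 3 * k + 3) + h (s + 3 * k + 4) + h (s + 3 * k + 5) \<le> c"
    using Suc.prems[of "Suc k"] by (simp add: algebra_simps)
  moreover have "3 * Suc k + 3 = Suc (Suc (Suc (3 * k + 3)))"
    by simp
  then have "(\<Sum>i<3 * Suc k + 3. h (s + i)) = (\<Sum>i<3 * k + 3. h (s + i))
      + h (s + 3 * k + 3) + h (s + 3 * k + 4) + h (s + 3 * k + 5)"
    by (simp only: sum.lessThan_Suc) (simp add: eval_nat_numeral)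
  \<comment> \<open>The two bounds add up to \<open>2 * c\<close>, which is at most \<open>c\<close>
    because \<open>c \<le> 0\<close>.\<close>
  ultimately show ?case
    using \<open>c \<le> 0\<close> by linarith
qed

text \<open>Remainders 1, 2, 3 instead of 0, 1, 2 always leave a nonempty tail after
  \<open>3 * k\<close> columns.\<close>

lemma nat_mod_3_cases:
  fixes n :: nat
  assumes "n \<ge> 1"
  obtains k where "n = Suc (3 * k)" | k where "n = Suc (Suc (3 * k))"
    | k where "n = Suc (Suc (Suc (3 * k)))"
proof -
  have "n = Suc (3 * ((n - 1) div 3)) \<or> n = Suc (Suc (3 * ((n - 1) div 3)))
      \<or> n = Suc (Suc (Suc (3 * ((n - 1) div 3))))"
    using assms by presburger
  then show thesis using that by blast
qed

text \<open>Disjoint windows tile the positions from 0 to \<open>n + 1\<close>, from 1 to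
  \<open>n + 1\<close>, or from 1 to \<open>n\<close>, according to whether \<open>n\<close> is 1, 2
  or 0 modulo 3. The positions outside the path carry 0, so they do not change the sum.\<close>

lemma path_sum_le:
  fixes h :: "nat \<Rightarrow> int"
  assumes window: "\<And>i. i \<in> {1..n} \<Longrightarrow> h (i - 1) + h i + h (i + 1) \<le> c"
    and "c \<le> 0" and "n \<ge> 1" and ends: "h 0 = 0" "h (n + 1) = 0"
  shows "(\<Sum>i=1..n. h i) \<le> c"
proof -
  have blocks: "(\<Sum>i<3 * k + 3. h (s + i)) \<le> c" if "s + 3 * k + 1 \<le> n" for s k
  proof (rule sum_blocks_le[OF _ \<open>c \<le> 0\<close>])
    fix j assume "j \<le> k"
    then show "h (s + 3 * j) + h (s + 3 * j + 1) + h (s + 3 * j + 2) \<le> c"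
      using window[of "s + 3 * j + 1"] that by simp
  qed
  have shift: "(\<Sum>i<m. h (1 + i)) = (\<Sum>i=1..m. h i)" for m
    by (induction m) auto
  show ?thesis
    using \<open>n \<ge> 1\<close>
  proof (cases rule: nat_mod_3_cases)
    case (1 k)
    have "3 * k + 3 = Suc (n + 1)"
      using 1 by simp
    then have "(\<Sum>i<3 * k + 3. h i) = (\<Sum>i<Suc (n + 1). h i)"
      by (simp only:)
    also have "\<dots> = (\<Sum>i=1..n. h i)"
      using shift[of "n + 1"] ends by (simp add: sum.lessThan_Suc_shift del: sum.lessThan_Suc)
    finally show ?thesis
      using blocks[of 0 k] 1 by simp
  next
    case (2 k)
    have "3 * k + 3 = n + 1"
      using 2 by simp
    then have "(\<Sum>i<3 * k + 3. h (1 + i)) = (\<Sum>i=1..n. h i)"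
      using shift[of "n + 1"] ends by (simp only:) simp
    then show ?thesis
      using blocks[of 1 k] 2 by simp
  next
    case (3 k)
    then have "3 * k + 3 = n"
      by simp
    then show ?thesis
      using blocks[of 1 k] shift[of n] by simp
  qed
qed

text \<open>The checkerboard class of \<open>(t, 1)\<close>, listed by column; \<open>3 - t\<close>
  is the opposite row.\<close>

definition zigzag :: "nat \<Rightarrow> nat \<Rightarrow> nat \<times> nat" where
  "zigzag t i = (if odd i then t else 3 - t, i)"

lemma weight_ladder_zigzag:
  "weight (ladder_graph n) f = (\<Sum>i=1..n. f (zigzag 1 i)) + (\<Sum>i=1..n. f (zigzag 2 i))"
proof -
  have "weight (ladder_graph n) f = (\<Sum>r\<in>{1, 2}. \<Sum>i=1..n. f (r, i))"
    by (simp add: weight_def verts_ladder sum.cartesian_product)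
  also have "\<dots> = (\<Sum>i=1..n. f (1, i) + f (2, i))"
    by (simp add: sum.distrib)
  also have "\<dots> = (\<Sum>i=1..n. f (zigzag 1 i) + f (zigzag 2 i))"
    by (intro sum.cong) (auto simp: zigzag_def)
  finally show ?thesis
    by (simp add: sum.distrib)
qed

lemma SRDF_complement_ladder_weight_ge:
  assumes f: "SRDF (complement_graph (ladder_graph n)) f" and "n \<ge> 1"
  shows "weight (ladder_graph n) f \<ge> 2"
proof (rule ccontr)
  define w where "w = weight (ladder_graph n) f"
  assume "\<not> weight (ladder_graph n) f \<ge> 2"
  \<comment> \<open>This supplies the sign condition \<open>w - 1 \<le> 0\<close> of
    \<open>path_sum_le\<close>.\<close>
  then have w: "w \<le> 1"
    by (simp add: w_def)
  define F where "F v = (if v \<in> verts (ladder_graph n) then f v else 0)" for v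
  have nbhd: "F (r, i - 1) + F (3 - r, i) + F (r, i + 1) \<le> w - 1"
    if "r \<in> {1, 2}" "i \<in> {1..n}" for r i
  proof -
    have "(r, i) \<in> verts (ladder_graph n)"
      using that by (simp add: verts_ladder)
    moreover from this have "(\<Sum>v\<in>closed_nbhd (complement_graph (ladder_graph n)) (r, i). f v) \<ge> 1"
      using f by (simp add: SRDF_def)
    ultimately show ?thesis
      using closed_nbhd_sum_complement[OF simple_graph_ladder, of "(r, i)" n f]
        ladder_nbhd_sum[OF that, of f, folded F_def]
      by (simp add: w_def)
  qed
  have zigzag_sum: "(\<Sum>i=1..n. f (zigzag t i)) \<le> w - 1" if t: "t \<in> {1, 2}" for t
  proof -
    have "(\<Sum>i=1..n. F (zigzag t i)) \<le> w - 1"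
    proof (rule path_sum_le)
      fix i assume i: "i \<in> {1..n}"
      then have "even (i - 1) \<longleftrightarrow> odd i"
        by auto
      \<comment> \<open>The window is the open neighbourhood of the vertex of the other zigzag in
        column \<open>i\<close>, which lies in row \<open>3 - t\<close> for odd \<open>i\<close> and
        in row \<open>t\<close> for even \<open>i\<close>.\<close>
      then show "F (zigzag t (i - 1)) + F (zigzag t i) + F (zigzag t (i + 1)) \<le> w - 1"
        using nbhd[OF _ i, of t] nbhd[OF _ i, of "3 - t"] t by (auto simp: zigzag_def)
    qed (use w \<open>n \<ge> 1\<close> in \<open>auto simp: F_def zigzag_def verts_ladder\<close>)
    also have "(\<Sum>i=1..n. F (zigzag t i)) = (\<Sum>i=1..n. f (zigzag t i))"
      using t by (intro sum.cong) (auto simp: F_def zigzag_def verts_ladder)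
    finally show ?thesis .
  qed
  show False
    using zigzag_sum[of 1] zigzag_sum[of 2] w weight_ladder_zigzag[of n f] by (simp add: w_def)
qed

section \<open>Upper bound: a labelling of weight 2\<close>

text \<open>Blocks 2, -1, -1 of sum 0 are followed by a tail of sum 1: the tail is 1, or 2, -1, or
  1, -1, 1, for \<open>n\<close> congruent to 1, 2, 0 modulo 3.\<close>

definition column_label :: "nat \<Rightarrow> nat \<Rightarrow> int" where
  "column_label n i =
     (if i = n \<and> n mod 3 \<noteq> 2 \<or> i + 2 = n \<and> n mod 3 = 0 then 1
      else if i mod 3 = 1 then 2 else -1)"

text \<open>Three consecutive entries of the periodic pattern sum to 0, so only windows touching an
  end need inspection. At the left end the window is 0, 2, -1, with sum exactly 1.\<close>

lemma column_label_window_le: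
  fixes n i :: nat
  defines "H \<equiv> \<lambda>j. if j \<in> {1..n} then column_label n j else 0"
  assumes "n \<ge> 4" "i \<in> {1..n}"
  shows "H (i - 1) + H i + H (i + 1) \<le> 1"
proof -
  \<comment> \<open>The last three columns become successors of \<open>m\<close>, so
    \<open>mod_Suc\<close> computes their labels from the residue of \<open>m\<close>.\<close>
  obtain m where m: "n = Suc (Suc (Suc m))" and "m \<ge> 1"
    using assms(2) that[of "n - 3"] by linarith
  consider "i = 1" | "1 < i" "i + 1 < n" | "1 < i" "i + 1 = n" | "1 < i" "i = n"
    using assms(3) by force
  then show ?thesis
  proof cases
    case 1
    then show ?thesis
      using assms(2) by (auto simp: H_def column_label_def)
  next
    case 2
    \<comment> \<open>Before column \<open>n\<close> the only possible adjustment, in column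
      \<open>n - 2\<close>, lowers a 2 to 1.\<close>
    have label: "H j \<le> (if j mod 3 = 1 then 2 else -1)" if "j < n" "1 \<le> j" for j
    proof -
      have "j mod 3 = 1" if "j + 2 = n" "n mod 3 = 0"
        using that by presburger
      then show ?thesis
        using \<open>j < n\<close> \<open>1 \<le> j\<close> by (auto simp: H_def column_label_def)
    qed
    obtain j where j: "i = Suc j"
      using 2 by (cases i) auto
    have "j mod 3 = 0 \<or> j mod 3 = 1 \<or> j mod 3 = 2"
      by linarith
    then show ?thesis
      using label[of j] label[of "Suc j"] label[of "Suc (Suc j)"] 2 j
      by (elim disjE) (simp_all add: mod_Suc)
  next
    case 3
    from \<open>m \<ge> 1\<close> show ?thesis
      by (cases rule: nat_mod_3_cases)
        (use 3 m in \<open>simp_all add: H_def column_label_def mod_Suc\<close>)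
  next
    case 4
    from \<open>m \<ge> 1\<close> show ?thesis
      by (cases rule: nat_mod_3_cases)
        (use 4 m in \<open>simp_all add: H_def column_label_def mod_Suc\<close>)
  qed
qed

lemma sum_column_label:
  assumes "n \<ge> 4"
  shows "(\<Sum>i=1..n. column_label n i) = 1"
proof -
  have periodic: "(\<Sum>i=1..3 * k. if i mod 3 = 1 then 2 else -1 :: int) = 0" for k :: nat
  proof (induction k)
    case (Suc k)
    have "3 * Suc k = Suc (Suc (Suc (3 * k)))"
      by simp
    with Suc show ?case
      by (simp add: mod_Suc del: mult_Suc_right)
  qed simp
  \<comment> \<open>The side conditions stop the sum before any adjusted column.\<close>
  have base: "(\<Sum>i=1..3 * k. column_label n i) = 0"
    if "3 * k < n" "n mod 3 = 0 \<longrightarrow> 3 * k + 3 \<le> n" for k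
  proof -
    have "(\<Sum>i=1..3 * k. column_label n i) = (\<Sum>i=1..3 * k. if i mod 3 = 1 then 2 else -1)"
      using that by (intro sum.cong) (auto simp: column_label_def)
    then show ?thesis
      using periodic by simp
  qed
  have "n \<ge> 1"
    using assms by simp
  then show ?thesis
  proof (cases rule: nat_mod_3_cases)
    case (1 k)
    moreover have "n mod 3 = 1"
      using 1 by (simp add: mod_Suc)
    ultimately show ?thesis
      using base[of k] by (simp add: column_label_def)
  next
    case (2 k)
    moreover have "n mod 3 = 2"
      using 2 by (simp add: mod_Suc)
    ultimately show ?thesis
      using base[of k] by (simp add: column_label_def mod_Suc)
  next
    case (3 k)
    then show ?thesis
      using base[of k] by (simp add: column_label_def mod_Suc)
  qed
qed

lemma SRDF_column_label:
  fixes n :: nat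
  assumes n: "n \<ge> 4"
  defines "f \<equiv> \<lambda>v :: nat \<times> nat. column_label n (snd v)"
  shows "SRDF (complement_graph (ladder_graph n)) f" and "weight (ladder_graph n) f = 2"
proof -
  show weight: "weight (ladder_graph n) f = 2"
    \<comment> \<open>Labels depend on the column only, so each zigzag contributes 1.\<close>
    using sum_column_label[OF n] by (simp add: weight_ladder_zigzag f_def zigzag_def)
  show "SRDF (complement_graph (ladder_graph n)) f"
    unfolding SRDF_def verts_complement
  proof (intro conjI ballI impI)
    show "f \<in> verts (ladder_graph n) \<rightarrow> {-1, 1, 2}"
      by (auto simp: f_def column_label_def)
  next
    fix u assume u: "u \<in> verts (ladder_graph n)"
    then obtain r i where ri: "u = (r, i)" "r \<in> {1, 2}" "i \<in> {1..n}"
      by (auto simp: verts_ladder)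
    have "(\<Sum>v\<in>{v \<in> verts (ladder_graph n). adjacent (ladder_graph n) u v}. f v) \<le> 1"
      using ladder_nbhd_sum[OF ri(2,3), of f] column_label_window_le[OF n ri(3)] ri
      by (auto simp: verts_ladder f_def)
    then show "(\<Sum>v\<in>closed_nbhd (complement_graph (ladder_graph n)) u. f v) \<ge> 1"
      using closed_nbhd_sum_complement[OF simple_graph_ladder u, of f] weight by simp
  next
    fix u assume u: "u \<in> verts (ladder_graph n)" and neg: "f u = -1"
    then obtain r i where ri: "u = (r, i)" "r \<in> {1, 2}" "i \<in> {1..n}"
      by (auto simp: verts_ladder)
    have first: "column_label n 1 = 2"
      using n by (auto simp: column_label_def)
    then have "i \<noteq> 1"
      using neg ri by (auto simp: f_def)
    \<comment> \<open>The opposite row is chosen because \<open>(r, 1)\<close> would be a ladder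
      neighbour of \<open>u\<close> when \<open>i = 2\<close>; \<open>(3 - r, 1)\<close> differs
      from \<open>u\<close> in both coordinates, hence is adjacent to it in the complement.\<close>
    moreover have v: "(3 - r, 1) \<in> verts (ladder_graph n)"
      using ri n by (auto simp: verts_ladder)
    ultimately have "adjacent (complement_graph (ladder_graph n)) u (3 - r, 1)"
      using adjacent_complement_iff[OF u v] adjacent_ladder_iff[OF ri(2,3) v] ri by auto
    with v first show "\<exists>v\<in>verts (ladder_graph n).
        adjacent (complement_graph (ladder_graph n)) u v \<and> f v = 2"
      by (auto simp: f_def)
  qed
qed

theorem theorem2:
  fixes n :: nat
  assumes "n \<ge> 4"
  shows "\<gamma>\<^sub>S\<^sub>R (complement_graph (ladder_graph n)) = 2"
  unfolding signed_Roman_domination_number_def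
proof (rule Min_eqI)
  show "finite {weight (complement_graph (ladder_graph n)) f |f.
                  SRDF (complement_graph (ladder_graph n)) f}"
    by (intro finite_SRDF_weights simple_graph_complement simple_graph_ladder)
  show "2 \<le> w" if "w \<in> {weight (complement_graph (ladder_graph n)) f |f.
                  SRDF (complement_graph (ladder_graph n)) f}" for w
    using that SRDF_complement_ladder_weight_ge assms by auto
  show "2 \<in> {weight (complement_graph (ladder_graph n)) f |f.
                  SRDF (complement_graph (ladder_graph n)) f}"
    using SRDF_column_label[OF assms] by force
qed

end
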